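(* Let $X$ be a topological linear space, $Y$ a Hilbert space, and $T\in LR(X,Y)$. Then: (i) $\tilde T_s$ is closed (closable) if and only if $\hat T_s$ is closed (closable); (ii) $T$ is closed (closable) if and only if $\hat T_s$ is closed (closable) and $T(0)$ is closed.
   Context: All spaces are over the same scalar field ($\mathbf R$ or $\mathbf C$). $LR(X,Y)$ is the set of all linear subspaces of $X\times Y$. For $T\in LR(X,Y)$: $D(T)$ is its domain, $T(x)=\{y\in Y:(x,y)\in T\}$. A (single-valued) linear operator is identified with its graph. For topological linear spaces $X,Y$, $\overline T$ is the closure of $T$ in $X\times Y$ (product topology); $T$ is closed if $\overline T=T$, and closable if $\overline T(x)=T(x)$ for each $x\in D(T)$. $\tilde T_s\in LR(X,Y/\overline{T(0)})$ is the linear operator with domain $D(T)$ given by $\tilde T_s(x)=[y]=y+\overline{T(0)}$ for any $y\in T(x)$, where $Y/\overline{T(0)}$ has the quotient norm. $\hat T_s\in LR(X,Y)$ is the linear operator with domain $D(T)$ given by $\hat T_s(x)=P_Ty$ for any $y\in T(x)$, where $P_T:Y\to\overline{T(0)}^\perp$ is the orthogonal projection. *)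

theory Defs
  imports "HOL-Analysis.Analysis" "HOL-Library.Set_Algebras"
begin

text \<open>
  The scalar field is a type of the following class, of which \<open>real\<close> and \<open>complex\<close> are
  instances. Up to isometric isomorphism there are no others: by the Gelfand-Mazur theorem a
  commutative real normed division algebra with multiplicative norm is the field of real or of
  complex numbers, and the last axiom then makes \<open>conj\<close> the usual conjugation.
\<close>

class rc_field = real_normed_field +
  fixes conj :: "'a \<Rightarrow> 'a"
  assumes conj_add: "conj (a + b) = conj a + conj b"
    and conj_mult: "conj (a * b) = conj a * conj b"
    and conj_conj: "conj (conj a) = a"
    and mult_conj: "a * conj a = (norm a)\<^sup>2 *\<^sub>R 1"

instantiation real :: rc_field
begin
definition conj_real :: "real \<Rightarrow> real" where "conj_real a = a"
instance by standard (simp_all add: conj_real_def power2_eq_square)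
end

instantiation complex :: rc_field
begin
definition conj_complex :: "complex \<Rightarrow> complex" where "conj_complex = cnj"
instance by standard (simp_all add: conj_complex_def scaleR_conv_of_real complex_norm_square[symmetric])
end

text \<open>No separation axiom is imposed on a topological linear space.\<close>

locale topological_linear_space = vector_space scale
  for scale :: "'k::rc_field \<Rightarrow> 'x::topological_ab_group_add \<Rightarrow> 'x" +
  assumes continuous_scale: "continuous_on UNIV (\<lambda>(a, x). scale a x)"

text \<open>
  The class \<open>banach\<close> supplies addition, the complete norm and its topology. It also carries a
  real scalar multiplication, which has to be the restriction of \<open>scale\<close>.
\<close>

locale hilbert_space = vector_space scale
  for scale :: "'k::rc_field \<Rightarrow> 'y::banach \<Rightarrow> 'y" +
  fixes ip :: "'y \<Rightarrow> 'y \<Rightarrow> 'k"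
  assumes scale_of_real: "scale (of_real r) y = r *\<^sub>R y"
    and ip_add_left: "ip (x + y) z = ip x z + ip y z"
    and ip_scale_left: "ip (scale a x) y = a * ip x y"
    and ip_commute: "ip y x = conj (ip x y)"
    and ip_self: "ip x x = of_real ((norm x)\<^sup>2)"

definition LR ::
  "('k::rc_field \<Rightarrow> 'x::ab_group_add \<Rightarrow> 'x) \<Rightarrow> ('k \<Rightarrow> 'y::ab_group_add \<Rightarrow> 'y) \<Rightarrow> ('x \<times> 'y) set set"
  where "LR sX sY = {T. module.subspace (module_prod.scale sX sY) T}"

text \<open>
  The topologies are explicit arguments because the quotient space below lives on a set of
  cosets. \<open>Domain T\<close> is $D(T)$ and \<open>T `` {x}\<close> is $T(x)$.
\<close>

definition rel_closed :: "'x topology \<Rightarrow> 'y topology \<Rightarrow> ('x \<times> 'y) set \<Rightarrow> bool"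
  where "rel_closed TX TY T \<longleftrightarrow> prod_topology TX TY closure_of T = T"

definition rel_closable :: "'x topology \<Rightarrow> 'y topology \<Rightarrow> ('x \<times> 'y) set \<Rightarrow> bool"
  where "rel_closable TX TY T \<longleftrightarrow>
    (\<forall>x\<in>Domain T. (prod_topology TX TY closure_of T) `` {x} = T `` {x})"

definition quot_space :: "'y::ab_group_add set \<Rightarrow> 'y set set"
  where "quot_space M = range (\<lambda>y. y +o M)"

text \<open>On a coset, \<open>infdist 0\<close> is the infimum of the norms of its elements.\<close>

definition quot_norm :: "'y::real_normed_vector set \<Rightarrow> real"
  where "quot_norm C = infdist 0 C"

definition quot_diff :: "'y::ab_group_add set \<Rightarrow> 'y set \<Rightarrow> 'y set"
  where "quot_diff C D = {c - d | c d. c \<in> C \<and> d \<in> D}"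

definition quot_topology :: "'y::real_normed_vector set \<Rightarrow> 'y set topology"
  where "quot_topology M =
    Metric_space.mtopology (quot_space M) (\<lambda>C D. quot_norm (quot_diff C D))"

lemma quot_diff_coset:
  assumes "subspace M"
  shows "quot_diff (y +o M) (z +o M) = (y - z) +o M"
proof (intro set_eqI iffI)
  fix u assume "u \<in> quot_diff (y +o M) (z +o M)"
  then obtain m n where "m \<in> M" "n \<in> M" "u = (y + m) - (z + n)"
    by (auto simp: quot_diff_def elt_set_plus_def)
  then have "m - n \<in> M" "u = (y - z) + (m - n)"
    using assms by (auto simp: subspace_diff algebra_simps)
  then show "u \<in> (y - z) +o M" by (auto simp: elt_set_plus_def)
next
  fix u assume "u \<in> (y - z) +o M"
  then obtain m where "m \<in> M" "u = (y + m) - (z + 0)"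
    by (auto simp: elt_set_plus_def)
  moreover have "0 \<in> M" using assms by (rule subspace_0)
  ultimately show "u \<in> quot_diff (y +o M) (z +o M)"
    unfolding quot_diff_def elt_set_plus_def by blast
qed

lemma quot_norm_coset:
  assumes "subspace M"
  shows "quot_norm (y +o M) = infdist y M"
proof -
  have eq: "dist 0 ` (y +o M) = dist y ` M"
  proof (intro set_eqI iffI)
    fix r assume "r \<in> dist 0 ` (y +o M)"
    then obtain m where "m \<in> M" "r = dist 0 (y + m)" by (auto simp: elt_set_plus_def)
    then have "- m \<in> M" "r = dist y (- m)"
      using assms by (auto simp: subspace_neg dist_norm norm_minus_commute add.commute)
    then show "r \<in> dist y ` M" by blast
  next
    fix r assume "r \<in> dist y ` M"
    then obtain m where "m \<in> M" "r = dist y m" by auto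
    then have "- m \<in> M" "r = dist 0 (y + - m)"
      using assms by (auto simp: subspace_neg dist_norm norm_minus_commute)
    then show "r \<in> dist 0 ` (y +o M)" unfolding elt_set_plus_def by blast
  qed
  have "0 \<in> M" using assms by (rule subspace_0)
  then have "M \<noteq> {}" "y +o M \<noteq> {}" by (auto simp: elt_set_plus_def)
  then show ?thesis by (simp add: quot_norm_def infdist_def eq del: dist_0_norm)
qed

lemma Metric_space_quot:
  assumes "subspace M" "closed M"
  shows "Metric_space (quot_space M) (\<lambda>C D. quot_norm (quot_diff C D))"
proof
  have ne: "M \<noteq> {}" using subspace_0[OF assms(1)] by blast
  have d: "quot_norm (quot_diff (y +o M) (z +o M)) = infdist (y - z) M" for y z
    by (simp add: quot_diff_coset quot_norm_coset assms(1))
  have "dist 0 ` quot_diff C D = dist 0 ` quot_diff D C"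
    for C D :: "'a set"
    unfolding quot_diff_def by (auto simp: image_iff) (metis norm_minus_commute)+
  moreover have "quot_diff C D = {} \<longleftrightarrow> quot_diff D C = {}" for C D :: "'a set"
    unfolding quot_diff_def by blast
  ultimately show "quot_norm (quot_diff C D) = quot_norm (quot_diff D C)" for C D :: "'a set"
    by (simp add: quot_norm_def infdist_def)
  show "0 \<le> quot_norm (quot_diff C D)" for C D :: "'a set"
    by (simp add: quot_norm_def infdist_nonneg)
  fix C D assume "C \<in> quot_space M" "D \<in> quot_space M"
  then obtain y z where C: "C = y +o M" and D: "D = z +o M" by (auto simp: quot_space_def)
  have "infdist (y - z) M = 0 \<longleftrightarrow> y - z \<in> M"
    using in_closed_iff_infdist_zero[OF assms(2) ne] by blast
  also have "\<dots> \<longleftrightarrow> y +o M = z +o M"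
  proof
    assume h: "y - z \<in> M"
    show "y +o M = z +o M"
    proof (intro set_eqI iffI)
      fix u assume "u \<in> y +o M"
      then obtain m where "m \<in> M" "u = y + m" by (auto simp: elt_set_plus_def)
      then have "(y - z) + m \<in> M" "u = z + ((y - z) + m)"
        using subspace_add[OF assms(1) h] by auto
      then show "u \<in> z +o M" unfolding elt_set_plus_def by blast
    next
      fix u assume "u \<in> z +o M"
      then obtain m where "m \<in> M" "u = z + m" by (auto simp: elt_set_plus_def)
      then have "m - (y - z) \<in> M" "u = y + (m - (y - z))"
        using subspace_diff[OF assms(1) _ h] by auto
      then show "u \<in> y +o M" unfolding elt_set_plus_def by blast
    qed
  next
    assume "y +o M = z +o M"
    moreover have "y \<in> y +o M"
      using subspace_0[OF assms(1)] by (force simp: elt_set_plus_def)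
    ultimately show "y - z \<in> M" by (auto simp: elt_set_plus_def)
  qed
  finally show "quot_norm (quot_diff C D) = 0 \<longleftrightarrow> C = D" by (simp add: C D d)
  fix E assume "E \<in> quot_space M"
  then obtain w where E: "E = w +o M" by (auto simp: quot_space_def)
  have "infdist (y - w) M \<le> infdist (y - z) M + infdist (z - w) M"
  proof (rule field_le_epsilon)
    fix e :: real assume "0 < e"
    have near: "\<exists>m\<in>M. dist v m < infdist v M + e / 2" for v
      using cInf_lessD[of "dist v ` M" "infdist v M + e / 2"] ne \<open>0 < e\<close>
      by (auto simp: infdist_notempty)
    then obtain m n where mn: "m \<in> M" "dist (y - z) m < infdist (y - z) M + e / 2"
      "n \<in> M" "dist (z - w) n < infdist (z - w) M + e / 2"
      by meson
    have "infdist (y - w) M \<le> dist (y - w) (m + n)"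
      by (intro infdist_le subspace_add assms mn)
    also have "\<dots> = norm ((y - z - m) + (z - w - n))"
      by (simp add: dist_norm algebra_simps)
    also have "\<dots> \<le> dist (y - z) m + dist (z - w) n"
      unfolding dist_norm by (rule norm_triangle_ineq)
    finally show "infdist (y - w) M \<le> infdist (y - z) M + infdist (z - w) M + e"
      using mn by simp
  qed
  then show "quot_norm (quot_diff C E) \<le> quot_norm (quot_diff C D) + quot_norm (quot_diff D E)"
    by (simp add: C D E d)
qed

text \<open>The operator $\tilde T_s$, with values in $Y / \overline{T(0)}$, as a graph.\<close>

definition op_tilde :: "('x::ab_group_add \<times> 'y::real_normed_vector) set \<Rightarrow> ('x \<times> 'y set) set"
  where "op_tilde T = {(x, y +o closure (T `` {0})) | x y. (x, y) \<in> T}"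

definition orth_compl :: "('y \<Rightarrow> 'y \<Rightarrow> 'k::rc_field) \<Rightarrow> 'y set \<Rightarrow> 'y set"
  where "orth_compl ip M = {y. \<forall>m\<in>M. ip y m = 0}"

text \<open>The orthogonal projection of \<open>y\<close> onto a closed linear subspace \<open>N\<close>.\<close>

definition orth_proj :: "('y::ab_group_add \<Rightarrow> 'y \<Rightarrow> 'k::rc_field) \<Rightarrow> 'y set \<Rightarrow> 'y \<Rightarrow> 'y"
  where "orth_proj ip N y = (THE p. p \<in> N \<and> y - p \<in> orth_compl ip N)"

text \<open>The operator $\hat T_s$, as a graph; the projection is $P_T$.\<close>

definition op_hat ::
  "('y \<Rightarrow> 'y \<Rightarrow> 'k::rc_field) \<Rightarrow> ('x::ab_group_add \<times> 'y::real_normed_vector) set \<Rightarrow> ('x \<times> 'y) set"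
  where "op_hat ip T =
    {(x, orth_proj ip (orth_compl ip (closure (T `` {0}))) y) | x y. (x, y) \<in> T}"

end

theory Submission
  imports Defs
begin

text \<open>
  Write \<open>M\<close> for the closure of \<open>T(0)\<close>. Both \<open>op_tilde T\<close> and \<open>op_hat ip T\<close> are images of \<open>T\<close>
  under a map \<open>id \<times> f\<close>, where \<open>f\<close> is the quotient map onto \<open>Y / M\<close> in the first case and the
  orthogonal projection \<open>P\<close> onto the complement of \<open>M\<close> in the second. The two choices of \<open>f\<close> share
  the properties that matter: \<open>f\<close> is continuous, open and onto, and \<open>f y = f z\<close> holds exactly
  when \<open>y - z \<in> M\<close>.

  Taking preimages under a continuous open map commutes with closure. Hence a relation \<open>S\<close> with
  values in the range of \<open>f\<close> is closed, or closable, exactly when its preimage under \<open>id \<times> f\<close> is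
  (lemmas \<open>rel_closed_iff_vimage\<close> and \<open>rel_closable_iff_vimage\<close>). Since the fibres of both maps
  are the cosets of \<open>M\<close>, the preimages of the two operators are one and the same relation
  \<open>T + {0} \<times> M\<close>, and this proves (i).

  For (ii), a closed or closable \<open>T\<close> has a closed section \<open>T(0)\<close>. If \<open>T(0)\<close> is closed, then
  \<open>M = T(0)\<close>, so that \<open>T + {0} \<times> M\<close> is \<open>T\<close> itself, and the equivalences already obtained
  speak about \<open>T\<close>.

  The properties of \<open>P\<close> come from the decomposition of \<open>Y\<close> as the sum of \<open>M\<close> and its orthogonal
  complement (lemma \<open>orthogonal_decomposition\<close>). It rests on the existence of nearest points in
  \<open>M\<close>, which the parallelogram law and completeness provide.
\<close>

section \<open>Relations and continuous open maps\<close>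

text \<open>
  Continuity gives the inclusion of the right side in the left. For the other inclusion,
  the image of a neighbourhood of \<open>x\<close> is a neighbourhood of \<open>f x\<close>, so it meets \<open>S\<close>.
\<close>

lemma closure_of_vimage_open_map:
  assumes cont: "continuous_map X Y f" and "open": "open_map X Y f"
  shows "{x \<in> topspace X. f x \<in> Y closure_of S} = X closure_of {x \<in> topspace X. f x \<in> S}"
proof (intro set_eqI iffI)
  fix x assume x: "x \<in> {x \<in> topspace X. f x \<in> Y closure_of S}"
  have "\<exists>y. y \<in> {x \<in> topspace X. f x \<in> S} \<and> y \<in> U" if U: "x \<in> U" "openin X U" for U
  proof -
    have "openin Y (f ` U)" using "open" U(2) by (simp add: open_map_def)
    then obtain u where "u \<in> U" "f u \<in> S"
      using x U(1) by (auto simp: in_closure_of)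
    then show ?thesis using openin_subset[OF U(2)] by blast
  qed
  then show "x \<in> X closure_of {x \<in> topspace X. f x \<in> S}"
    using x by (auto simp: in_closure_of)
next
  fix x assume x: "x \<in> X closure_of {x \<in> topspace X. f x \<in> S}"
  then have xX: "x \<in> topspace X" by (simp add: in_closure_of)
  have "f x \<in> Y closure_of (f ` {x \<in> topspace X. f x \<in> S})"
    using continuous_map_image_closure_subset[OF cont] x by blast
  moreover have "f ` {x \<in> topspace X. f x \<in> S} \<subseteq> S" by blast
  ultimately show "x \<in> {x \<in> topspace X. f x \<in> Y closure_of S}"
    using xX closure_of_mono[of "f ` {x \<in> topspace X. f x \<in> S}" S Y] by blast
qed

lemma open_map_map_prod_id:
  assumes "open_map Y Z f"
  shows "open_map (prod_topology X Y) (prod_topology X Z) (map_prod id f)"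
  unfolding open_map_def
proof (intro allI impI)
  fix W assume W: "openin (prod_topology X Y) W"
  show "openin (prod_topology X Z) (map_prod id f ` W)"
    unfolding openin_prod_topology_alt
  proof (intro allI impI)
    fix x z assume "(x, z) \<in> map_prod id f ` W"
    then obtain y where y: "(x, y) \<in> W" "z = f y" by auto
    then obtain U V where UV: "openin X U" "openin Y V" "x \<in> U" "y \<in> V" "U \<times> V \<subseteq> W"
      using W unfolding openin_prod_topology_alt by meson
    have "openin Z (f ` V)" using assms UV(2) by (simp add: open_map_def)
    moreover have "U \<times> f ` V \<subseteq> map_prod id f ` W" using UV(5) by force
    ultimately show "\<exists>U V. openin X U \<and> openin Z V \<and> x \<in> U \<and> z \<in> V \<and> U \<times> V \<subseteq> map_prod id f ` W"
      using UV y(2) by blast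
  qed
qed

lemma continuous_map_map_prod_id:
  assumes "continuous_map Y Z f"
  shows "continuous_map (prod_topology X Y) (prod_topology X Z) (map_prod id f)"
proof -
  have "continuous_map (prod_topology X Y) (prod_topology X Z) (\<lambda>(x, y). (id x, f y))"
    by (rule continuous_map_prod_top[THEN iffD2]) (simp add: assms)
  then show ?thesis by (simp add: map_prod_def)
qed

lemma closure_of_vimage_map_prod_id:
  fixes f :: "'y::topological_space \<Rightarrow> 'z" and S :: "('x::topological_space \<times> 'z) set"
  assumes "continuous_map euclidean TZ f" "open_map euclidean TZ f"
  shows "prod_topology euclidean euclidean closure_of (map_prod id f -` S)
       = map_prod id f -` (prod_topology euclidean TZ closure_of S)"
  using closure_of_vimage_open_map[OF continuous_map_map_prod_id[OF assms(1)]
      open_map_map_prod_id[OF assms(2)], of euclidean S]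
  by (simp add: vimage_def del: prod_topology_euclidean)

text \<open>
  Surjectivity of \<open>f\<close> lets an equality of sets be tested on the preimages.
\<close>

lemma rel_closed_iff_vimage:
  fixes f :: "'y::topological_space \<Rightarrow> 'z" and S :: "('x::topological_space \<times> 'z) set"
  assumes f: "continuous_map euclidean TZ f" "open_map euclidean TZ f" "range f = topspace TZ"
    and S: "Range S \<subseteq> range f"
  shows "rel_closed euclidean TZ S \<longleftrightarrow> rel_closed euclidean euclidean (map_prod id f -` S)"
proof -
  let ?C = "prod_topology euclidean TZ closure_of S"
  have "UNIV \<times> range f = range (map_prod (id :: 'x \<Rightarrow> 'x) f)"
    by (auto simp: image_iff map_prod_def)
  moreover have "S \<subseteq> UNIV \<times> range f" using S by auto
  moreover have "?C \<subseteq> UNIV \<times> range f"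
    using closure_of_subset_topspace[of "prod_topology euclidean TZ" S] f(3) by auto
  ultimately have "?C = S \<longleftrightarrow> map_prod id f -` ?C = map_prod id f -` S"
    by (metis image_vimage_eq inf.absorb1)
  then show ?thesis
    unfolding rel_closed_def closure_of_vimage_map_prod_id[OF f(1,2)] .
qed

lemma rel_closable_iff_vimage:
  fixes f :: "'y::topological_space \<Rightarrow> 'z" and S :: "('x::topological_space \<times> 'z) set"
  assumes f: "continuous_map euclidean TZ f" "open_map euclidean TZ f" "range f = topspace TZ"
    and S: "Range S \<subseteq> range f"
  shows "rel_closable euclidean TZ S \<longleftrightarrow> rel_closable euclidean euclidean (map_prod id f -` S)"
proof -
  have dom: "Domain (map_prod id f -` S) = Domain S"
    using S by (force simp: Domain_iff)
  have section_vimage: "(map_prod id f -` A) `` {x} = f -` (A `` {x})"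
    for A :: "('x \<times> 'z) set" and x
    by auto
  let ?C = "prod_topology euclidean TZ closure_of S"
  have "?C `` {x} = S `` {x} \<longleftrightarrow> f -` (?C `` {x}) = f -` (S `` {x})" for x
  proof -
    have "?C `` {x} \<subseteq> range f"
      using closure_of_subset_topspace[of "prod_topology euclidean TZ" S] f(3) by auto
    moreover have "S `` {x} \<subseteq> range f" using S by auto
    ultimately show ?thesis by (metis image_vimage_eq inf.absorb1)
  qed
  then show ?thesis
    unfolding rel_closable_def closure_of_vimage_map_prod_id[OF f(1,2)] dom section_vimage
    by simp
qed

text \<open>
  An orthogonal projection is open only as a map onto its range, whereas closedness of
  \<open>op_hat ip T\<close> refers to the whole of \<open>Y\<close>. The range is closed, so no limit points are lost in
  passing to it.
\<close>

lemma closure_of_prod_subtopology: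
  assumes "closedin Y A" "Range S \<subseteq> A"
  shows "prod_topology X (subtopology Y A) closure_of S = prod_topology X Y closure_of S"
proof -
  let ?P = "prod_topology X Y"
  have sub: "prod_topology X (subtopology Y A) = subtopology ?P (UNIV \<times> A)"
    using subtopology_Times[of X Y UNIV A] by simp
  have "closedin ?P (topspace X \<times> A)"
    using assms(1) by (simp add: closedin_prod_Times_iff)
  moreover have "topspace ?P \<inter> S \<subseteq> topspace X \<times> A" using assms(2) by auto
  ultimately have "?P closure_of S \<subseteq> UNIV \<times> A"
    using closure_of_minimal[of "topspace ?P \<inter> S" "topspace X \<times> A" ?P]
    unfolding closure_of_restrict[of ?P S, symmetric] by blast
  moreover have "S \<subseteq> UNIV \<times> A" using assms(2) by auto
  ultimately show ?thesis
    unfolding sub by (simp add: closure_of_subtopology_open Int_absorb1)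
qed

section \<open>The quotient map\<close>

lemma coset_eq_iff_diff_mem:
  fixes M :: "'y::real_normed_vector set"
  assumes "subspace M"
  shows "y +o M = z +o M \<longleftrightarrow> y - z \<in> M"
proof
  assume "y +o M = z +o M"
  moreover have "y \<in> y +o M"
    using subspace_0[OF assms] by (force simp: elt_set_plus_def)
  ultimately show "y - z \<in> M" by (auto simp: elt_set_plus_def)
next
  assume "y - z \<in> M"
  then have "(y - z) +o M = M"
    using assms by (force simp: elt_set_plus_def intro: subspace_add dest: subspace_diff)
  then have "z +o ((y - z) +o M) = z +o M" by simp
  then show "y +o M = z +o M" by (simp add: set_plus_rearrange2)
qed

lemma topspace_quot_topology:
  assumes "subspace M" "closed M"
  shows "topspace (quot_topology M) = range (\<lambda>y. y +o M)"
  using Metric_space.topspace_mtopology[OF Metric_space_quot[OF assms]]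
  by (simp add: quot_topology_def quot_space_def)

lemma openin_quot_topology:
  fixes M :: "'y::real_normed_vector set"
  assumes M: "subspace M" "closed M"
  shows "openin (quot_topology M) U \<longleftrightarrow> U \<subseteq> range (\<lambda>y. y +o M) \<and>
    (\<forall>y. y +o M \<in> U \<longrightarrow> (\<exists>r>0. \<forall>z. infdist (y - z) M < r \<longrightarrow> z +o M \<in> U))"
proof -
  interpret Q: Metric_space "quot_space M" "\<lambda>C D. quot_norm (quot_diff C D)"
    by (rule Metric_space_quot[OF M])
  have d: "quot_norm (quot_diff (y +o M) (z +o M)) = infdist (y - z) M" for y z
    by (simp add: quot_diff_coset quot_norm_coset M(1))
  have ball: "Q.mball (y +o M) r \<subseteq> U \<longleftrightarrow> (\<forall>z. infdist (y - z) M < r \<longrightarrow> z +o M \<in> U)" for y r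
    unfolding Q.mball_def by (auto simp: quot_space_def d)
  have "(\<forall>C. C \<in> U \<longrightarrow> (\<exists>r>0. Q.mball C r \<subseteq> U)) \<longleftrightarrow>
      (\<forall>y. y +o M \<in> U \<longrightarrow> (\<exists>r>0. Q.mball (y +o M) r \<subseteq> U))"
    if "U \<subseteq> range (\<lambda>y. y +o M)"
    using that by blast
  then show ?thesis
    unfolding quot_topology_def Q.openin_mtopology ball
    by (auto simp only: quot_space_def)
qed

lemma continuous_map_coset:
  fixes M :: "'y::real_normed_vector set"
  assumes M: "subspace M" "closed M"
  shows "continuous_map euclidean (quot_topology M) (\<lambda>y. y +o M)"
proof -
  have "open {y. y +o M \<in> U}" if U: "openin (quot_topology M) U" for U
    unfolding open_dist
  proof (intro ballI)
    fix y assume "y \<in> {y. y +o M \<in> U}"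
    then obtain r where r: "r > 0" "\<And>z. infdist (y - z) M < r \<Longrightarrow> z +o M \<in> U"
      using U unfolding openin_quot_topology[OF M] by blast
    have "infdist (y - z) M \<le> dist z y" for z
      using infdist_le[OF subspace_0[OF M(1)], of "y - z"]
      by (simp add: dist_norm norm_minus_commute)
    then show "\<exists>e>0. \<forall>z. dist z y < e \<longrightarrow> z \<in> {y. y +o M \<in> U}"
      using r by (metis mem_Collect_eq order_le_less_trans)
  qed
  then show ?thesis
    by (auto simp: continuous_map topspace_quot_topology[OF M])
qed

text \<open>
  A coset near that of \<open>y\<close> in the quotient norm has a representative near \<open>y\<close>.
\<close>

lemma open_map_coset:
  fixes M :: "'y::real_normed_vector set"
  assumes M: "subspace M" "closed M"
  shows "open_map euclidean (quot_topology M) (\<lambda>y. y +o M)"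
  unfolding open_map_def openin_quot_topology[OF M]
proof (intro allI impI conjI)
  fix U :: "'y set" and y assume U: "openin euclidean U" and "y +o M \<in> (\<lambda>y. y +o M) ` U"
  then obtain u where u: "u \<in> U" "y +o M = u +o M" by auto
  then obtain e where e: "e > 0" "\<And>v. dist v u < e \<Longrightarrow> v \<in> U"
    using U by (auto simp: open_dist)
  have "z +o M \<in> (\<lambda>y. y +o M) ` U" if z: "infdist (y - z) M < e" for z
  proof -
    have ne: "M \<noteq> {}" using subspace_0[OF M(1)] by blast
    obtain m where m: "m \<in> M" "dist (y - z) m < e"
      using cInf_lessD[of "dist (y - z) ` M" e] z ne by (auto simp: infdist_notempty)
    have yu: "y - u \<in> M" using u(2) coset_eq_iff_diff_mem[OF M(1)] by blast
    let ?v = "z + m - (y - u)"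
    have "dist ?v u < e"
      using m(2) by (simp add: dist_norm norm_minus_commute algebra_simps)
    moreover have "?v +o M = z +o M"
      using subspace_diff[OF M(1) m(1) yu]
      by (simp add: coset_eq_iff_diff_mem[OF M(1)] algebra_simps)
    ultimately show ?thesis using e(2) by (metis imageI)
  qed
  then show "\<exists>r>0. \<forall>z. infdist (y - z) M < r \<longrightarrow> z +o M \<in> (\<lambda>y. y +o M) ` U"
    using e(1) by blast
qed auto

section \<open>The orthogonal projection\<close>

context hilbert_space
begin

lemma ip_zero_left [simp]: "ip 0 y = 0"
  using ip_add_left[of 0 0 y] by simp

lemma ip_diff_left: "ip (x - y) z = ip x z - ip y z"
  using ip_add_left[of "x - y" y z] by simp

lemma conj_zero: "conj (0::'k) = 0"
  using conj_add[of "0::'k" 0] by simp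

lemma ip_zero_commute: "ip x y = 0 \<longleftrightarrow> ip y x = 0"
  by (metis ip_commute conj_zero)

lemma ip_add_right: "ip x (y + z) = ip x y + ip x z"
  by (metis ip_commute ip_add_left conj_add)

lemma ip_diff_right: "ip x (y - z) = ip x y - ip x z"
  using ip_add_right[of x "y - z" z] by simp

lemma norm_scale: "norm (scale a y) = norm a * norm y"
proof -
  have "ip (scale a y) (scale a y) = a * (conj a * ip y y)"
    by (metis ip_commute conj_mult ip_scale_left)
  also have "\<dots> = of_real ((norm a * norm y)\<^sup>2)"
    using mult_conj[of a]
    by (simp add: ip_self mult.assoc[symmetric] scaleR_conv_of_real power_mult_distrib)
  finally have "(norm (scale a y))\<^sup>2 = (norm a * norm y)\<^sup>2"
    unfolding ip_self of_real_eq_iff .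
  then show ?thesis by (simp add: power2_eq_iff_nonneg)
qed

lemma parallelogram:
  fixes x y :: 'y
  shows "(norm (x + y))\<^sup>2 + (norm (x - y))\<^sup>2 = 2 * (norm x)\<^sup>2 + 2 * (norm y)\<^sup>2"
proof -
  have "ip (x + y) (x + y) + ip (x - y) (x - y) = 2 * ip x x + 2 * ip y y"
    by (simp add: ip_add_left ip_add_right ip_diff_left ip_diff_right)
  then have "of_real ((norm (x + y))\<^sup>2 + (norm (x - y))\<^sup>2)
      = (of_real (2 * (norm x)\<^sup>2 + 2 * (norm y)\<^sup>2) :: 'k)"
    by (simp add: ip_self)
  then show ?thesis unfolding of_real_eq_iff .
qed

lemma pythagoras:
  assumes "ip x y = 0"
  shows "(norm (x + y))\<^sup>2 = (norm x)\<^sup>2 + (norm y)\<^sup>2"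
proof -
  have "ip (x + y) (x + y) = ip x x + ip y y"
    using assms ip_zero_commute by (simp add: ip_add_left ip_add_right)
  then have "of_real ((norm (x + y))\<^sup>2) = (of_real ((norm x)\<^sup>2 + (norm y)\<^sup>2) :: 'k)"
    by (simp add: ip_self)
  then show ?thesis unfolding of_real_eq_iff .
qed

lemma real_subspace_if_subspace:
  assumes "subspace M"
  shows "real_vector.subspace M"
proof (rule real_vector.subspaceI)
  show "c *\<^sub>R x \<in> M" if "x \<in> M" for c x
    using subspace_scale[OF assms that, of "of_real c"] by (simp add: scale_of_real)
qed (use assms subspace_0 subspace_add in auto)

lemma subspace_closure:
  assumes "subspace M"
  shows "subspace (closure M)"
proof (rule subspaceI)
  show "0 \<in> closure M" using subspace_0[OF assms] closure_subset by blast
  show "x + y \<in> closure M" if xy: "x \<in> closure M" "y \<in> closure M" for x y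
  proof -
    obtain f g where "\<forall>n. f n \<in> M" "f \<longlonglongrightarrow> x" "\<forall>n. g n \<in> M" "g \<longlonglongrightarrow> y"
      using xy unfolding closure_sequential by blast
    then have "\<forall>n. f n + g n \<in> M" "(\<lambda>n. f n + g n) \<longlonglongrightarrow> x + y"
      using subspace_add[OF assms] by (auto intro: tendsto_add)
    then show ?thesis
      unfolding closure_sequential by (intro exI[of _ "\<lambda>n. f n + g n"]) blast
  qed
  show "scale c x \<in> closure M" if x: "x \<in> closure M" for c x
    unfolding closure_approachable
  proof (intro allI impI)
    fix e :: real assume "e > 0"
    then have "e / (norm c + 1) > 0" by (simp add: add_nonneg_pos)
    then obtain m where m: "m \<in> M" "dist m x < e / (norm c + 1)"
      using x unfolding closure_approachable by blast
    have "dist (scale c m) (scale c x) = norm c * dist m x"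
      by (simp add: dist_norm norm_scale flip: scale_right_diff_distrib)
    also have "\<dots> \<le> (norm c + 1) * dist m x" by (simp add: mult_right_mono)
    also have "\<dots> < e"
      using m(2) by (simp add: pos_less_divide_eq add_nonneg_pos mult.commute)
    finally show "\<exists>y\<in>M. dist y (scale c x) < e"
      using m(1) subspace_scale[OF assms] by blast
  qed
qed

text \<open>
  The points of \<open>M\<close> that are nearly closest to \<open>y\<close> form nested closed sets. By the parallelogram
  law their diameters tend to zero: the midpoint of two such points is again at distance at least
  \<open>infdist y M\<close> from \<open>y\<close>. Completeness gives a common point.
\<close>

lemma nearest_point_exists:
  fixes y :: 'y
  assumes M: "real_vector.subspace M" "closed M"
  shows "\<exists>p\<in>M. \<forall>m\<in>M. norm (y - p) \<le> norm (y - m)"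
proof -
  define d where "d = infdist y M"
  define S where "S n = {p \<in> M. (norm (y - p))\<^sup>2 \<le> d\<^sup>2 + inverse (real (Suc n))}" for n
  have ne: "M \<noteq> {}" using real_vector.subspace_0[OF M(1)] by blast
  have d0: "d \<ge> 0" by (simp add: d_def infdist_nonneg)
  have d_le: "d \<le> norm (y - m)" if "m \<in> M" for m
    using infdist_le[OF that, of y] by (simp add: d_def dist_norm)
  have closed_S: "closed (S n)" for n
    unfolding S_def Collect_conj_eq
    by (intro closed_Int closed_Collect_le continuous_intros) (simp add: M(2))
  have S_ne: "S n \<noteq> {}" for n
  proof -
    have "d < sqrt (d\<^sup>2 + inverse (real (Suc n)))"
      using d0 by (intro real_less_rsqrt) simp
    then obtain m where m: "m \<in> M" "norm (y - m) < sqrt (d\<^sup>2 + inverse (real (Suc n)))"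
      using cInf_lessD[of "dist y ` M"] ne
      by (auto simp: d_def infdist_notempty dist_norm)
    have "(norm (y - m))\<^sup>2 \<le> (sqrt (d\<^sup>2 + inverse (real (Suc n))))\<^sup>2"
      using m(2) by (intro power_mono) auto
    then have "(norm (y - m))\<^sup>2 \<le> d\<^sup>2 + inverse (real (Suc n))" by simp
    then show ?thesis using m(1) by (auto simp: S_def)
  qed
  have S_mono: "S n \<subseteq> S m" if "m \<le> n" for m n
  proof -
    have "inverse (real (Suc n)) \<le> inverse (real (Suc m))" using that by (simp add: field_simps)
    then show ?thesis unfolding S_def by (auto simp del: of_nat_Suc intro: order_trans)
  qed
  have S_diam: "\<exists>n. \<forall>p\<in>S n. \<forall>q\<in>S n. dist p q < e" if e: "e > 0" for e
  proof -
    obtain n where n: "inverse (real (Suc n)) < e\<^sup>2 / 4"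
      using reals_Archimedean[of "e\<^sup>2 / 4"] e by auto
    have "dist p q < e" if pq: "p \<in> S n" "q \<in> S n" for p q
    proof -
      have "(1/2) *\<^sub>R (p + q) \<in> M"
        using pq M(1) by (auto simp: S_def intro: real_vector.subspace_scale real_vector.subspace_add)
      then have "d \<le> norm (y - (1/2) *\<^sub>R (p + q))" by (rule d_le)
      also have "\<dots> = norm ((1/2) *\<^sub>R ((y - p) + (y - q)))"
        by (rule arg_cong[where f = norm]) (simp add: algebra_simps flip: scaleR_add_left)
      also have "\<dots> = norm ((y - p) + (y - q)) / 2" by simp
      finally have "(2 * d)\<^sup>2 \<le> (norm ((y - p) + (y - q)))\<^sup>2"
        using d0 by (intro power_mono) auto
      moreover have "(norm ((y - p) + (y - q)))\<^sup>2 + (norm (p - q))\<^sup>2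
          = 2 * (norm (y - p))\<^sup>2 + 2 * (norm (y - q))\<^sup>2"
        using parallelogram[of "y - p" "y - q"] by (simp add: norm_minus_commute)
      ultimately have "(norm (p - q))\<^sup>2 < e\<^sup>2"
        using pq n by (simp add: S_def power_mult_distrib)
      then show ?thesis using e by (simp add: dist_norm power_less_imp_less_base)
    qed
    then show ?thesis by blast
  qed
  obtain p where p: "\<And>n. p \<in> S n"
    using decreasing_closed_nest[of S] closed_S S_ne S_mono S_diam by blast
  have "(norm (y - p))\<^sup>2 \<le> d\<^sup>2"
  proof (rule field_le_epsilon)
    fix e :: real assume "e > 0"
    then obtain n where "inverse (real (Suc n)) < e" using reals_Archimedean by blast
    then show "(norm (y - p))\<^sup>2 \<le> d\<^sup>2 + e" using p[of n] by (simp add: S_def)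
  qed
  then have "norm (y - p) \<le> d" using d0 by (simp add: power_mono_iff)
  then show ?thesis using p[of 0] d_le by (force simp: S_def)
qed

text \<open>
  Subtracting from \<open>w\<close> its component along \<open>m\<close> would shorten \<open>w\<close> unless that component vanishes.
\<close>

lemma orthogonal_if_nearest:
  assumes M: "subspace M" and nearest: "\<And>m. m \<in> M \<Longrightarrow> norm w \<le> norm (w - m)" and m: "m \<in> M"
  shows "ip w m = 0"
proof (cases "m = 0")
  case True
  then show ?thesis using ip_zero_commute ip_zero_left by blast
next
  case False
  define u where "u = scale (ip w m / of_real ((norm m)\<^sup>2)) m"
  have "ip u m = ip w m"
    using False by (simp add: u_def ip_scale_left ip_self)
  then have "ip (w - u) m = 0" by (simp add: ip_diff_left)
  then have "ip m (w - u) = 0" by (simp add: ip_zero_commute)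
  then have "ip u (w - u) = 0" by (simp add: u_def ip_scale_left)
  then have "(norm w)\<^sup>2 = (norm u)\<^sup>2 + (norm (w - u))\<^sup>2"
    using pythagoras[of u "w - u"] by simp
  moreover have "(norm w)\<^sup>2 \<le> (norm (w - u))\<^sup>2"
    using M m by (intro power_mono nearest) (auto simp: u_def subspace_scale)
  ultimately have "u = 0" by simp
  then show ?thesis using \<open>ip u m = ip w m\<close> by simp
qed

lemma orthogonal_decomposition:
  assumes M: "subspace M" "closed M"
  obtains q where "q \<in> orth_compl ip M" "y - q \<in> M"
proof -
  obtain p where p: "p \<in> M" "\<And>m. m \<in> M \<Longrightarrow> norm (y - p) \<le> norm (y - m)"
    using nearest_point_exists[OF real_subspace_if_subspace[OF M(1)] M(2)] by blast
  have "ip (y - p) m = 0" if "m \<in> M" for m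
  proof (rule orthogonal_if_nearest[OF M(1) _ that])
    show "norm (y - p) \<le> norm (y - p - m)" if "m \<in> M" for m
      using p(2)[OF subspace_add[OF M(1) p(1) that]] by (simp add: algebra_simps)
  qed
  then show ?thesis using that[of "y - p"] p(1) by (auto simp: orth_compl_def)
qed

lemma orth_proj_compl_eqI:
  assumes q: "q \<in> orth_compl ip M" "y - q \<in> M"
  shows "orth_proj ip (orth_compl ip M) y = q"
  unfolding orth_proj_def
proof (rule the_equality)
  show "q \<in> orth_compl ip M \<and> y - q \<in> orth_compl ip (orth_compl ip M)"
    using q ip_zero_commute by (auto simp: orth_compl_def)
next
  fix r assume r: "r \<in> orth_compl ip M \<and> y - r \<in> orth_compl ip (orth_compl ip M)"
  \<comment> \<open>The difference of two candidates is orthogonal to itself.\<close>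
  have "q - r \<in> orth_compl ip M"
    using q(1) r by (simp add: orth_compl_def ip_diff_left)
  then have "ip (y - r) (q - r) = 0" "ip (q - r) (y - q) = 0"
    using q(2) r by (auto simp: orth_compl_def)
  then have "ip (y - r) (q - r) = 0" "ip (y - q) (q - r) = 0"
    using ip_zero_commute by blast+
  then have "ip (q - r) (q - r) = 0" by (simp add: ip_diff_left)
  then show "r = q" by (simp add: ip_self)
qed

context
  fixes M :: "'y set"
  assumes M: "subspace M" "closed M"
begin

abbreviation (input) "P \<equiv> orth_proj ip (orth_compl ip M)"

lemma orth_proj_compl_mem: "P y \<in> orth_compl ip M"
  and diff_orth_proj_compl_mem: "y - P y \<in> M"
  using orth_proj_compl_eqI orthogonal_decomposition[OF M, of y] by metis+

lemma orth_proj_compl_diff: "P (y - z) = P y - P z"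
proof (rule orth_proj_compl_eqI)
  show "P y - P z \<in> orth_compl ip M"
    using orth_proj_compl_mem[of y] orth_proj_compl_mem[of z]
    by (simp add: orth_compl_def ip_diff_left)
  show "y - z - (P y - P z) \<in> M"
    using subspace_diff[OF M(1) diff_orth_proj_compl_mem[of y] diff_orth_proj_compl_mem[of z]]
    by (simp add: algebra_simps)
qed

lemma orth_proj_compl_fixes:
  assumes "q \<in> orth_compl ip M"
  shows "P q = q"
  using assms subspace_0[OF M(1)] by (simp add: orth_proj_compl_eqI)

lemma orth_proj_compl_eq_0_iff: "P y = 0 \<longleftrightarrow> y \<in> M"
proof
  show "P y = 0 \<Longrightarrow> y \<in> M" using diff_orth_proj_compl_mem[of y] by simp
  show "y \<in> M \<Longrightarrow> P y = 0" by (rule orth_proj_compl_eqI) (simp_all add: orth_compl_def)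
qed

lemma orth_proj_compl_eq_iff: "P y = P z \<longleftrightarrow> y - z \<in> M"
  using orth_proj_compl_eq_0_iff[of "y - z"] by (simp add: orth_proj_compl_diff)

lemma norm_orth_proj_compl_le: "norm (P y) \<le> norm y"
proof -
  have "ip (P y) (y - P y) = 0"
    using orth_proj_compl_mem diff_orth_proj_compl_mem by (auto simp: orth_compl_def)
  then have "(norm y)\<^sup>2 = (norm (P y))\<^sup>2 + (norm (y - P y))\<^sup>2"
    using pythagoras[of "P y" "y - P y"] by simp
  then have "(norm (P y))\<^sup>2 \<le> (norm y)\<^sup>2" by simp
  then show ?thesis by (rule power2_le_imp_le) simp
qed

lemma range_orth_proj_compl: "range P = orth_compl ip M"
  using orth_proj_compl_mem orth_proj_compl_fixes
  by (metis image_subset_iff rangeI subsetI subset_antisym)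

lemma continuous_on_orth_proj_compl: "continuous_on UNIV P"
  unfolding continuous_on_iff
proof (intro ballI allI impI)
  fix y and e :: real assume "e > 0"
  moreover have "dist (P z) (P y) \<le> dist z y" for z
    using norm_orth_proj_compl_le[of "z - y"] by (simp add: dist_norm orth_proj_compl_diff)
  ultimately show "\<exists>d>0. \<forall>z\<in>UNIV. dist z y < d \<longrightarrow> dist (P z) (P y) < e"
    by (meson order_le_less_trans)
qed

lemma closed_orth_compl: "closed (orth_compl ip M)"
proof -
  have "orth_compl ip M = {y. P y = y}"
    using orth_proj_compl_mem orth_proj_compl_fixes
    by (metis (mono_tags, lifting) Collect_cong Collect_mem_eq)
  moreover have "closed {y. P y = y}"
    by (intro closed_Collect_eq continuous_on_orth_proj_compl continuous_on_id)
  ultimately show ?thesis by simp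
qed

lemma continuous_map_orth_proj_compl:
  "continuous_map euclidean (top_of_set (orth_compl ip M)) P"
  using continuous_on_orth_proj_compl orth_proj_compl_mem
  by (auto simp: continuous_map_in_subtopology)

text \<open>
  A displacement within the complement can be carried over to any preimage.
\<close>

lemma open_map_orth_proj_compl:
  "open_map euclidean (top_of_set (orth_compl ip M)) P"
  unfolding open_map_def
proof (intro allI impI)
  fix U :: "'y set" assume "openin euclidean U"
  then have U: "open U" by simp
  show "openin (top_of_set (orth_compl ip M)) (P ` U)"
    unfolding openin_euclidean_subtopology_iff
  proof (intro conjI ballI)
    show "P ` U \<subseteq> orth_compl ip M" using orth_proj_compl_mem by blast
    fix z assume "z \<in> P ` U"
    then obtain y where y: "y \<in> U" "z = P y" by blast
    then obtain e where e: "e > 0" "\<And>v. dist v y < e \<Longrightarrow> v \<in> U"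
      using U by (auto simp: open_dist)
    have "w \<in> P ` U" if w: "w \<in> orth_compl ip M" "dist w z < e" for w
    proof
      show "y + (w - z) \<in> U" using w(2) by (intro e(2)) (simp add: dist_norm)
      have "P (y - (z - w)) = P y - (P z - P w)" by (simp add: orth_proj_compl_diff)
      also have "\<dots> = w" using w(1) y(2) orth_proj_compl_mem by (simp add: orth_proj_compl_fixes)
      finally show "w = P (y + (w - z))" by (simp add: algebra_simps)
    qed
    then show "\<exists>e>0. \<forall>w\<in>orth_compl ip M. dist w z < e \<longrightarrow> w \<in> P ` U"
      using e(1) by blast
  qed
qed

end

end

section \<open>Linear relations\<close>

lemma vector_space_pairI:
  assumes "vector_space s1" "vector_space s2"
  shows "vector_space_prod s1 s2"
  using assms by (simp add: vector_space_prod_def vector_space_pair_def)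

lemma LR_add:
  assumes "vector_space sX" "vector_space sY" "T \<in> LR sX sY" "(x, y) \<in> T" "(x', y') \<in> T"
  shows "(x + x', y + y') \<in> T"
proof -
  interpret vector_space_prod sX sY by (intro vector_space_pairI assms)
  show ?thesis using p.subspace_add[of T "(x, y)" "(x', y')"] assms by (simp add: LR_def)
qed

lemma LR_scale:
  assumes "vector_space sX" "vector_space sY" "T \<in> LR sX sY" "(x, y) \<in> T"
  shows "(sX a x, sY a y) \<in> T"
proof -
  interpret vector_space_prod sX sY by (intro vector_space_pairI assms)
  show ?thesis using p.subspace_scale[of T "(x, y)" a] assms by (simp add: LR_def scale_prod)
qed

lemma LR_zero:
  assumes "vector_space sX" "vector_space sY" "T \<in> LR sX sY"
  shows "(0, 0) \<in> T"
proof -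
  interpret vector_space_prod sX sY by (intro vector_space_pairI assms)
  show ?thesis using p.subspace_0[of T] assms by (simp add: LR_def zero_prod_def)
qed

lemma subspace_LR_zero:
  assumes "vector_space sX" "vector_space sY" "T \<in> LR sX sY"
  shows "module.subspace sY (T `` {0})"
proof -
  interpret X: vector_space sX by (rule assms)
  interpret Y: vector_space sY by (rule assms)
  show ?thesis
  proof (rule Y.subspaceI)
    show "0 \<in> T `` {0}" using LR_zero[OF assms] by simp
    show "y + z \<in> T `` {0}" if "y \<in> T `` {0}" "z \<in> T `` {0}" for y z
      using that LR_add[OF assms, of 0 y 0 z] by simp
    show "sY c y \<in> T `` {0}" if "y \<in> T `` {0}" for c y
      using that LR_scale[OF assms, of 0 y c] by simp
  qed
qed

lemma closed_section:
  fixes S :: "('x::topological_space \<times> 'y::topological_space) set"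
  assumes "closed S"
  shows "closed (S `` {x})"
proof -
  have "S `` {x} = Pair x -` S" by auto
  moreover have "closed (Pair x -` S)"
    by (intro closed_vimage assms continuous_intros)
  ultimately show ?thesis by simp
qed

lemma closed_section_if_rel_closable:
  fixes S :: "('x::topological_space \<times> 'y::topological_space) set"
  assumes "rel_closable euclidean euclidean S" "x \<in> Domain S"
  shows "closed (S `` {x})"
  using assms closed_section[of "closure S" x] by (simp add: rel_closable_def)

lemma rel_closable_if_rel_closed:
  "rel_closed TX TY S \<Longrightarrow> rel_closable TX TY S"
  by (simp add: rel_closed_def rel_closable_def)

text \<open>
  For \<open>x\<close> in the domain, \<open>T(x)\<close> is a coset of \<open>T(0)\<close>, so adding \<open>T(0)\<close> to it changes nothing.
\<close>

lemma LR_coset_saturation: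
  assumes "vector_space sX" "vector_space sY" "T \<in> LR sX sY"
  shows "{(x, y). \<exists>z. (x, z) \<in> T \<and> y - z \<in> T `` {0}} = T"
proof (intro set_eqI iffI; clarify)
  fix x y z assume "(x, z) \<in> T" "(0, y - z) \<in> T"
  then show "(x, y) \<in> T" using LR_add[OF assms, of x z 0 "y - z"] by simp
next
  fix x y assume "(x, y) \<in> T"
  then show "\<exists>z. (x, z) \<in> T \<and> y - z \<in> T `` {0}"
    using LR_zero[OF assms] by (intro exI[of _ y]) simp
qed

theorem theorem4p1:
  fixes scaleX :: "'k::rc_field \<Rightarrow> 'x::topological_ab_group_add \<Rightarrow> 'x"
    and scaleY :: "'k \<Rightarrow> 'y::banach \<Rightarrow> 'y"
    and ip :: "'y \<Rightarrow> 'y \<Rightarrow> 'k"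
    and T :: "('x \<times> 'y) set"
  assumes "topological_linear_space scaleX"
    and "hilbert_space scaleY ip"
    and "T \<in> LR scaleX scaleY"
  shows "(rel_closed euclidean (quot_topology (closure (T `` {0}))) (op_tilde T)
            \<longleftrightarrow> rel_closed euclidean euclidean (op_hat ip T))
       \<and> (rel_closable euclidean (quot_topology (closure (T `` {0}))) (op_tilde T)
            \<longleftrightarrow> rel_closable euclidean euclidean (op_hat ip T))
       \<and> (rel_closed euclidean euclidean T
            \<longleftrightarrow> rel_closed euclidean euclidean (op_hat ip T) \<and> closed (T `` {0}))
       \<and> (rel_closable euclidean euclidean T
            \<longleftrightarrow> rel_closable euclidean euclidean (op_hat ip T) \<and> closed (T `` {0}))"
proof -
  interpret H: hilbert_space scaleY ip by (rule assms(2))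
  have vs: "vector_space scaleX" "vector_space scaleY"
    using assms(1) topological_linear_space.axioms(1) H.vector_space_axioms by blast+
  define M where "M = closure (T `` {0})"
  define N where "N = orth_compl ip M"
  define P where "P = orth_proj ip N"
  \<comment> \<open>The common preimage of the two operators.\<close>
  define sat where "sat = {(x, y). \<exists>z. (x, z) \<in> T \<and> y - z \<in> M}"
  have M: "H.subspace M" "closed M"
    using H.subspace_closure[OF subspace_LR_zero[OF vs assms(3)]] by (simp_all add: M_def)
  have rM: "subspace M" by (rule H.real_subspace_if_subspace[OF M(1)])
  have tilde: "op_tilde T = {(x, y +o M) | x y. (x, y) \<in> T}"
    by (simp add: op_tilde_def M_def)
  have hat: "op_hat ip T = {(x, P y) | x y. (x, y) \<in> T}"
    by (simp add: op_hat_def P_def N_def M_def)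
  have sat_tilde: "map_prod id (\<lambda>y. y +o M) -` op_tilde T = sat"
    by (auto simp: tilde sat_def coset_eq_iff_diff_mem[OF rM])
  have sat_hat: "map_prod id P -` op_hat ip T = sat"
    by (auto simp: hat sat_def P_def N_def H.orth_proj_compl_eq_iff[OF M])
  have rangeP: "range P = N"
    by (simp add: P_def N_def H.range_orth_proj_compl[OF M])
  have range_tilde: "Range (op_tilde T) \<subseteq> range (\<lambda>y. y +o M)" by (auto simp: tilde)
  have range_hat: "Range (op_hat ip T) \<subseteq> range P" by (auto simp: hat)
  note q = continuous_map_coset[OF rM M(2)] open_map_coset[OF rM M(2)]
    topspace_quot_topology[OF rM M(2), symmetric]
  have p: "continuous_map euclidean (top_of_set N) P" "open_map euclidean (top_of_set N) P"
    "range P = topspace (top_of_set N)"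
    using H.continuous_map_orth_proj_compl[OF M] H.open_map_orth_proj_compl[OF M] rangeP
    by (simp_all add: P_def N_def)
  have subtop: "prod_topology euclidean (top_of_set N) closure_of op_hat ip T
      = prod_topology euclidean euclidean closure_of op_hat ip T"
    using H.closed_orth_compl[OF M] range_hat rangeP
    by (intro closure_of_prod_subtopology) (simp_all add: N_def)
  have closed_tilde: "rel_closed euclidean (quot_topology M) (op_tilde T)
      \<longleftrightarrow> rel_closed euclidean euclidean sat"
    using rel_closed_iff_vimage[OF q range_tilde] by (simp add: sat_tilde)
  have closable_tilde: "rel_closable euclidean (quot_topology M) (op_tilde T)
      \<longleftrightarrow> rel_closable euclidean euclidean sat"
    using rel_closable_iff_vimage[OF q range_tilde] by (simp add: sat_tilde)
  have closed_hat: "rel_closed euclidean euclidean (op_hat ip T)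
      \<longleftrightarrow> rel_closed euclidean euclidean sat"
    using rel_closed_iff_vimage[OF p range_hat] by (simp add: sat_hat rel_closed_def subtop)
  have closable_hat: "rel_closable euclidean euclidean (op_hat ip T)
      \<longleftrightarrow> rel_closable euclidean euclidean sat"
    using rel_closable_iff_vimage[OF p range_hat] by (simp add: sat_hat rel_closable_def subtop)
  have sat_T: "sat = T" if "closed (T `` {0})"
    using LR_coset_saturation[OF vs assms(3)] that by (simp add: sat_def M_def)
  have closed_T0: "closed (T `` {0})" if "rel_closable euclidean euclidean T"
    using LR_zero[OF vs assms(3)] by (intro closed_section_if_rel_closable[OF that]) blast
  show ?thesis
    unfolding M_def[symmetric] closed_tilde closable_tilde closed_hat closable_hat
    using sat_T closed_T0 rel_closable_if_rel_closed by metis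
qed

end
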